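(* For all $1\le k\le n$ and any $1<\delta\le 2$, there exists a $\delta$-balanced $(n,k)$-family of perfect hash functions of size $O\!\left(\frac{e^k\sqrt{k}\log n}{(\delta-1)^2}\right)$, where the implied constant is absolute.
   Context: $[n]=\{1,\dots,n\}$ and $\binom{[n]}{k}$ is the family of $k$-element subsets of $[n]$. For $1\le k\le n$ and $\delta\ge 1$, a family (multiset) of functions from $[n]$ to $[k]$ is a $\delta$-balanced $(n,k)$-family of perfect hash functions if there is a real $T>0$ such that for every $S\in\binom{[n]}{k}$ the number of functions in the family that are one-to-one on $S$ lies between $T/\delta$ and $\delta T$. The size of a family is its number of functions.
   Formalization: The bound uses log max(n,2) in place of log n: for n = 1 the stated bound is 0, which no balanced family can meet since T > 0 forces a nonempty family; for all n ≥ 2 the bound is unchanged. *)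

theory Defs
  imports Complex_Main "HOL-Library.Multiset" "HOL-Library.FuncSet"
begin

text \<open>
  A family is a finite multiset of functions, so that repeated functions are counted with
  multiplicity; taking the functions extensional makes each function from \<open>{1..n}\<close> to \<open>{1..k}\<close>
  correspond to exactly one HOL function.
\<close>

definition balanced_perfect_hash_family :: "real \<Rightarrow> nat \<Rightarrow> nat \<Rightarrow> (nat \<Rightarrow> nat) multiset \<Rightarrow> bool"
  where "balanced_perfect_hash_family \<delta> n k F \<longleftrightarrow>
    set_mset F \<subseteq> ({1..n} \<rightarrow>\<^sub>E {1..k}) \<and>
    (\<exists>T::real. T > 0 \<and>
      (\<forall>S. S \<subseteq> {1..n} \<and> card S = k \<longrightarrow>
        T / \<delta> \<le> real (size {#f \<in># F. inj_on f S#}) \<and>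
        real (size {#f \<in># F. inj_on f S#}) \<le> \<delta> * T))"

end

theory Submission imports Defs
begin

text \<open>
  Let \<open>p = k! / k ^ k\<close> be the proportion of functions that are one-to-one on a fixed \<open>k\<close>-set.
  By a Chernoff bound, \<open>M\<close> independent uniformly random functions work with positive probability
  as soon as \<open>M * p * (\<delta> - 1)\<^sup>2\<close> exceeds a constant times \<open>ln (n choose k) \<le> k * ln n\<close>, and
  Stirling's lower bound on \<open>k!\<close> gives \<open>1 / p = O(exp k / sqrt k)\<close>. The probabilistic argument is
  run in derandomised form: functions are added one at a time, never increasing the sum of the
  exponential moments.
\<close>

section \<open>Elementary inequalities and Stirling's lower bound\<close>

lemma exp_le_quadratic:
  fixes x :: real
  assumes "\<bar>x\<bar> \<le> 1"
  shows "exp x \<le> 1 + x + x\<^sup>2"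
proof (cases "0 \<le> x")
  case True
  then show ?thesis using assms by (intro exp_bound) auto
next
  case False
  have nonneg: "0 \<le> 1 + x + x\<^sup>2" using assms by (auto intro: add_nonneg_nonneg)
  \<comment> \<open>The product is \<open>1 - x^3\<close>, and \<open>1 - x\<close> is at most
    \<open>exp (- x)\<close>. Negative arguments matter later for the lower tail.\<close>
  have "1 \<le> (1 + x + x\<^sup>2) * (1 - x)"
  proof -
    have "(1 + x + x\<^sup>2) * (1 - x) = 1 + x\<^sup>2 * (- x)"
      by (simp add: algebra_simps power2_eq_square)
    moreover have "0 \<le> x\<^sup>2 * (- x)"
      using False by (intro mult_nonneg_nonneg) auto
    ultimately show ?thesis by linarith
  qed
  also have "\<dots> \<le> (1 + x + x\<^sup>2) * exp (- x)"
    using exp_ge_add_one_self[of "- x"] by (intro mult_left_mono[OF _ nonneg]) simp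
  finally have "1 * exp x \<le> ((1 + x + x\<^sup>2) * exp (- x)) * exp x"
    by (intro mult_right_mono) auto
  then show ?thesis by (simp only: mult.assoc flip: exp_add) simp
qed

text \<open>The difference of the two sides vanishes at 0 and has derivative
  \<open>y^3 / (1 + y)\<close>, which is nonnegative.\<close>

lemma ln_one_plus_le_cubic:
  fixes x :: real
  assumes "0 \<le> x"
  shows "ln (1 + x) \<le> x - x\<^sup>2 / 2 + x ^ 3 / 3"
proof -
  let ?g = "\<lambda>x::real. x - x\<^sup>2 / 2 + x ^ 3 / 3 - ln (1 + x)"
  have "?g 0 \<le> ?g x"
  proof (rule DERIV_nonneg_imp_nondecreasing[OF assms])
    fix y :: real
    assume y: "0 \<le> y" "y \<le> x"
    have "(?g has_real_derivative 1 - y + y\<^sup>2 - 1 / (1 + y)) (at y)"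
      using y by (auto intro!: derivative_eq_intros simp: power2_eq_square)
    moreover have "1 - y + y\<^sup>2 - 1 / (1 + y) = y ^ 3 / (1 + y)"
      using y by (simp add: field_simps power2_eq_square power3_eq_cube)
    ultimately show "\<exists>D. DERIV ?g y :> D \<and> D \<ge> 0"
      using y by (intro exI[of _ "y ^ 3 / (1 + y)"]) auto
  qed
  then show ?thesis by simp
qed

text \<open>The term \<open>1 / (2 * k)\<close> is what makes Stirling's lower bound provable by induction.\<close>

lemma ln_fact_ge:
  assumes "1 \<le> k"
  shows "(real k + 1/2) * ln (real k) - real k + 1 / (2 * real k) + 1/2 \<le> ln (fact k)"
  using assms
proof (induction k rule: nat_induct_at_least)
  case base
  then show ?case by simp
next
  case (Suc k)
  define x where "x = 1 / real k"
  have k: "real k \<ge> 1" using Suc by simp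
  then have x: "0 < x" "x \<le> 1" by (auto simp: x_def)
  have kx: "real k = 1 / x" by (simp add: x_def)
  have "real (Suc k) = real k * (1 + x)"
    using k by (simp add: x_def field_simps)
  then have ln_Suc: "ln (real (Suc k)) = ln (real k) + ln (1 + x)"
    using k x by (simp add: ln_mult)
  have ln_fact_Suc: "ln (fact (Suc k) :: real) = ln (real (Suc k)) + ln (fact k)"
    by (simp only: fact_Suc of_nat_mult) (simp add: ln_mult)
  \<comment> \<open>The factor \<open>1 / x + 1/2\<close> cancels the terms linear in
    \<open>x\<close>, so the excess over 1 is of second order. It is then absorbed by the decrease
    of \<open>1 / (2 * k)\<close> from \<open>k\<close> to \<open>Suc k\<close>, which is at least
    \<open>x^2 / 4\<close>.\<close>
  have "(real k + 1/2) * ln (1 + x) \<le> (real k + 1/2) * (x - x\<^sup>2 / 2 + x ^ 3 / 3)"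
    using x ln_one_plus_le_cubic[of x] by (intro mult_left_mono) auto
  also have "\<dots> = 1 + x\<^sup>2 / 12 + x ^ 3 / 6"
    using x unfolding kx by (simp add: field_simps power2_eq_square power3_eq_cube)
  also have "\<dots> \<le> 1 + x\<^sup>2 / 4"
  proof -
    have "x ^ 3 \<le> x\<^sup>2"
      using x by (intro power_decreasing) auto
    then show ?thesis by simp
  qed
  also have "\<dots> \<le> 1 + (1 / (2 * real k) - 1 / (2 * real (Suc k)))"
  proof -
    have "x\<^sup>2 / 4 = 1 / (real k * (4 * real k))"
      by (simp add: x_def power2_eq_square)
    also have "\<dots> \<le> 1 / (real k * (2 * real (Suc k)))"
      using k by (intro divide_left_mono mult_left_mono mult_pos_pos) auto
    also have "\<dots> = 1 / (2 * real k) - 1 / (2 * real (Suc k))"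
      using k by (simp add: diff_divide_eq_iff) (simp add: field_simps)
    finally show ?thesis by simp
  qed
  finally have "(real k + 1/2) * ln (1 + x) \<le> 1 + (1 / (2 * real k) - 1 / (2 * real (Suc k)))" .
  moreover have "(real (Suc k) + 1/2) * ln (real (Suc k)) =
      ln (real (Suc k)) + (real k + 1/2) * ln (real k) + (real k + 1/2) * ln (1 + x)"
    using ln_Suc by (simp add: algebra_simps)
  ultimately show ?case
    using Suc.IH ln_fact_Suc by simp
qed

lemma power_self_le_fact:
  assumes "1 \<le> k"
  shows "real k ^ k * sqrt (real k) \<le> exp (real k) * fact k"
proof -
  have k: "real k > 0" using assms by simp
  have "exp ((real k + 1/2) * ln (real k)) = exp (real k * ln (real k)) * exp (ln (real k) / 2)"
    by (simp add: algebra_simps flip: exp_add)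
  also have "\<dots> = real k ^ k * sqrt (real k)"
    using k by (simp add: exp_of_nat_mult flip: ln_sqrt)
  finally have "real k ^ k * sqrt (real k) = exp ((real k + 1/2) * ln (real k))" by simp
  also have "\<dots> \<le> exp (real k + ln (fact k))"
  proof -
    have "0 \<le> 1 / (2 * real k)" by simp
    then show ?thesis using ln_fact_ge[OF assms] by (subst exp_le_cancel_iff) linarith
  qed
  finally show ?thesis by (simp add: exp_add)
qed

section \<open>Exponential moments and the greedy choice of functions\<close>

lemma sum_exp_indicator_le:
  fixes \<theta> p :: real
  assumes "finite \<Omega>" and "real (card {f \<in> \<Omega>. P f}) = p * real (card \<Omega>)"
  shows "(\<Sum>f\<in>\<Omega>. exp (\<theta> * of_bool (P f) - p * (exp \<theta> - 1))) \<le> real (card \<Omega>)"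
proof -
  have "(\<Sum>f\<in>\<Omega>. exp (\<theta> * of_bool (P f))) = (\<Sum>f\<in>\<Omega>. 1 + (if P f then exp \<theta> - 1 else 0))"
    by (intro sum.cong) auto
  also have "\<dots> = real (card \<Omega>) + real (card {f \<in> \<Omega>. P f}) * (exp \<theta> - 1)"
    using assms(1) by (simp add: sum.distrib Int_def flip: sum.inter_filter)
  also have "\<dots> = real (card \<Omega>) * (1 + p * (exp \<theta> - 1))"
    using assms(2) by (simp add: algebra_simps)
  \<comment> \<open>Bounding the exact mean \<open>1 + p * (exp \<theta> - 1)\<close> by an
    exponential makes the normalisation additive in the exponent, hence easy to carry through many
    draws.\<close>
  also have "\<dots> \<le> real (card \<Omega>) * exp (p * (exp \<theta> - 1))"
    by (intro mult_left_mono exp_ge_add_one_self) auto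
  finally have "(\<Sum>f\<in>\<Omega>. exp (\<theta> * of_bool (P f))) \<le> real (card \<Omega>) * exp (p * (exp \<theta> - 1))" .
  then show ?thesis
    by (simp add: exp_diff divide_le_eq flip: sum_divide_distrib)
qed

lemma exists_le_average:
  fixes g :: "'a \<Rightarrow> real"
  assumes "finite A" "A \<noteq> {}" "sum g A \<le> real (card A) * c"
  shows "\<exists>a\<in>A. g a \<le> c"
proof (rule ccontr)
  assume "\<not> ?thesis"
  then have "sum (\<lambda>_. c) A < sum g A"
    using assms by (intro sum_strict_mono) (auto simp: not_le)
  then show False using assms(3) by simp
qed

text \<open>Method of conditional expectations: for the empty multiset every summand is 1, and
  averaged over the next function the potential does not grow, so some function keeps it within the
  bound for all \<open>i\<close> and \<theta> together.\<close>

lemma exists_multiset_exp_moment_le: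
  fixes hit :: "'f \<Rightarrow> 'i \<Rightarrow> bool" and p :: real
  assumes \<Omega>: "finite \<Omega>" "\<Omega> \<noteq> {}"
    and p: "\<And>i. i \<in> I \<Longrightarrow> real (card {f \<in> \<Omega>. hit f i}) = p * real (card \<Omega>)"
  shows "\<exists>F. set_mset F \<subseteq> \<Omega> \<and> size F = M \<and>
    (\<Sum>i\<in>I. \<Sum>\<theta>\<in>\<Theta>. exp (\<theta> * real (size {#f \<in># F. hit f i#}) - real M * (p * (exp \<theta> - 1))))
      \<le> real (card I) * real (card \<Theta>)"
proof (induction M)
  case 0
  show ?case by simp
next
  case (Suc M)
  then obtain F where F: "set_mset F \<subseteq> \<Omega>" "size F = M" and
    le: "(\<Sum>i\<in>I. \<Sum>\<theta>\<in>\<Theta>. exp (\<theta> * real (size {#f \<in># F. hit f i#}) - real M * (p * (exp \<theta> - 1))))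
      \<le> real (card I) * real (card \<Theta>)" (is "(\<Sum>i\<in>I. \<Sum>\<theta>\<in>\<Theta>. ?w i \<theta>) \<le> _")
    by blast
  \<comment> \<open>Adding \<open>f\<close> to \<open>F\<close> multiplies the summand at
    \<open>i\<close> and \<theta> by this factor.\<close>
  let ?e = "\<lambda>f i \<theta>. exp (\<theta> * of_bool (hit f i) - p * (exp \<theta> - 1))"
  have "(\<Sum>f\<in>\<Omega>. \<Sum>i\<in>I. \<Sum>\<theta>\<in>\<Theta>. ?w i \<theta> * ?e f i \<theta>) = (\<Sum>i\<in>I. \<Sum>\<theta>\<in>\<Theta>. ?w i \<theta> * (\<Sum>f\<in>\<Omega>. ?e f i \<theta>))"
    by (subst sum.swap, rule sum.cong[OF refl], subst sum.swap) (simp add: sum_distrib_left)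
  also have "\<dots> \<le> (\<Sum>i\<in>I. \<Sum>\<theta>\<in>\<Theta>. ?w i \<theta> * real (card \<Omega>))"
    using \<Omega> p by (intro sum_mono mult_left_mono sum_exp_indicator_le) auto
  also have "\<dots> = real (card \<Omega>) * (\<Sum>i\<in>I. \<Sum>\<theta>\<in>\<Theta>. ?w i \<theta>)"
    by (simp add: sum_distrib_left mult.commute)
  also have "\<dots> \<le> real (card \<Omega>) * (real (card I) * real (card \<Theta>))"
    using le by (intro mult_left_mono) auto
  finally obtain g where g: "g \<in> \<Omega>"
      "(\<Sum>i\<in>I. \<Sum>\<theta>\<in>\<Theta>. ?w i \<theta> * ?e g i \<theta>) \<le> real (card I) * real (card \<Theta>)"
    using exists_le_average[OF \<Omega>] by blast
  have "?w i \<theta> * ?e g i \<theta> =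
      exp (\<theta> * real (size {#f \<in># add_mset g F. hit f i#}) - real (Suc M) * (p * (exp \<theta> - 1)))" for i \<theta>
    by (simp add: algebra_simps flip: exp_add)
  with g F show ?case
    by (intro exI[of _ "add_mset g F"]) simp
qed

lemma exists_balanced_multiset:
  fixes hit :: "'f \<Rightarrow> 'i \<Rightarrow> bool" and p \<epsilon> :: real
  assumes \<Omega>: "finite \<Omega>" "\<Omega> \<noteq> {}" and I: "finite I"
    and p: "\<And>i. i \<in> I \<Longrightarrow> real (card {f \<in> \<Omega>. hit f i}) = p * real (card \<Omega>)"
    and "0 \<le> p" and \<epsilon>: "0 < \<epsilon>" "\<epsilon> \<le> 1"
    and M: "ln (2 * real (card I)) \<le> real M * p * \<epsilon>\<^sup>2 / 16"
  shows "\<exists>F. set_mset F \<subseteq> \<Omega> \<and> size F = M \<and>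
    (\<forall>i\<in>I. real M * p / (1 + \<epsilon>) \<le> real (size {#f \<in># F. hit f i#}) \<and>
      real (size {#f \<in># F. hit f i#}) \<le> (1 + \<epsilon>) * (real M * p))"
proof -
  \<comment> \<open>The positive exponent yields the upper bound, the negative one the lower bound.
    With \<open>\<epsilon> / 4\<close>, the logarithmic term \<open>T * \<epsilon>^2 / 16\<close>
    equals the quadratic error \<open>T * \<theta>^2\<close>; divided by
    \<open>\<epsilon> / 4\<close>, the two add up to a deviation of
    \<open>T * \<epsilon> / 2\<close>.\<close>
  define \<Theta> where "\<Theta> = {\<epsilon> / 4, - \<epsilon> / 4}"
  have \<Theta>: "finite \<Theta>" "card \<Theta> = 2" using \<epsilon> by (auto simp: \<Theta>_def)
  define T where "T = real M * p"
  have T: "0 \<le> T" using \<open>0 \<le> p\<close> by (simp add: T_def)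
  obtain F where F: "set_mset F \<subseteq> \<Omega>" "size F = M" and
    le: "(\<Sum>i\<in>I. \<Sum>\<theta>\<in>\<Theta>. exp (\<theta> * real (size {#f \<in># F. hit f i#}) - real M * (p * (exp \<theta> - 1))))
      \<le> real (card I) * real (card \<Theta>)" (is "(\<Sum>i\<in>I. \<Sum>\<theta>\<in>\<Theta>. ?w i \<theta>) \<le> _")
    by atomize_elim (rule exists_multiset_exp_moment_le[OF \<Omega> p])
  have "T / (1 + \<epsilon>) \<le> real (size {#f \<in># F. hit f i#}) \<and>
      real (size {#f \<in># F. hit f i#}) \<le> (1 + \<epsilon>) * T" if i: "i \<in> I" for i
  proof -
    define X where "X = real (size {#f \<in># F. hit f i#})"
    have "card I > 0" using I i by (auto simp: card_gt_0_iff)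
    \<comment> \<open>All summands are positive, so each one is at most the bound
      \<open>2 * card I\<close> on the whole sum; then take logarithms.\<close>
    have moment: "\<theta> * X \<le> T * \<epsilon>\<^sup>2 / 16 + T * (\<theta> + \<theta>\<^sup>2)" if \<theta>: "\<theta> \<in> \<Theta>" for \<theta>
    proof -
      have "?w i \<theta> \<le> (\<Sum>\<theta>\<in>\<Theta>. ?w i \<theta>)"
        using \<theta> \<Theta> by (intro member_le_sum) auto
      also have "\<dots> \<le> (\<Sum>i\<in>I. \<Sum>\<theta>\<in>\<Theta>. ?w i \<theta>)"
        using i I by (intro member_le_sum[where f = "\<lambda>i. \<Sum>\<theta>\<in>\<Theta>. ?w i \<theta>"] sum_nonneg) auto
      also have "\<dots> \<le> 2 * real (card I)" using le \<Theta> by simp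
      finally have "\<theta> * X - T * (exp \<theta> - 1) \<le> ln (2 * real (card I))"
        using \<open>card I > 0\<close> by (simp add: ln_ge_iff X_def T_def mult.assoc)
      also have "\<dots> \<le> T * \<epsilon>\<^sup>2 / 16" using M by (simp add: T_def)
      finally have "\<theta> * X \<le> T * \<epsilon>\<^sup>2 / 16 + T * (exp \<theta> - 1)" by simp
      also have "T * (exp \<theta> - 1) \<le> T * (\<theta> + \<theta>\<^sup>2)"
        using exp_le_quadratic[of \<theta>] \<epsilon> \<theta> T by (intro mult_left_mono) (auto simp: \<Theta>_def)
      finally show ?thesis by simp
    qed
    have "\<epsilon> / 4 * X \<le> \<epsilon> / 4 * (T * (1 + \<epsilon> / 2))"
      using moment[of "\<epsilon> / 4"] by (simp add: \<Theta>_def algebra_simps power2_eq_square)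
    then have "X \<le> T * (1 + \<epsilon> / 2)" using \<epsilon> by simp
    also have "\<dots> \<le> (1 + \<epsilon>) * T" using T \<epsilon> by (simp add: algebra_simps)
    finally have upper: "X \<le> (1 + \<epsilon>) * T" .
    have "\<epsilon> / 4 * (T * (1 - \<epsilon> / 2)) \<le> \<epsilon> / 4 * X"
      using moment[of "- \<epsilon> / 4"] by (simp add: \<Theta>_def algebra_simps power2_eq_square)
    then have lower: "T * (1 - \<epsilon> / 2) \<le> X" using \<epsilon> by simp
    \<comment> \<open>The product is \<open>1 + \<epsilon> * (1 - \<epsilon>) / 2\<close>, so
      \<epsilon> at most 1 turns the additive lower bound into division by
      \<open>1 + \<epsilon>\<close>.\<close>
    have "1 \<le> (1 - \<epsilon> / 2) * (1 + \<epsilon>)"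
      using \<epsilon> mult_left_mono[of \<epsilon> 1 \<epsilon>] by (simp add: algebra_simps)
    then have "T * 1 \<le> T * ((1 - \<epsilon> / 2) * (1 + \<epsilon>))"
      using T by (rule mult_left_mono)
    also have "\<dots> \<le> X * (1 + \<epsilon>)"
      using lower \<epsilon> by (simp add: mult.assoc[symmetric])
    finally show ?thesis
      using upper \<epsilon> by (simp add: X_def divide_le_eq)
  qed
  then show ?thesis using F unfolding T_def by blast
qed

section \<open>Counting injective functions and k-element sets\<close>

lemma card_inj_on_PiE:
  fixes n k :: nat
  assumes S: "S \<subseteq> {1..n}" "card S = k" and k: "1 \<le> k"
  shows "real (card {f \<in> {1..n} \<rightarrow>\<^sub>E {1..k}. inj_on f S}) =
    fact k / real k ^ k * real (card ({1..n} \<rightarrow>\<^sub>E {1..k}))"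
proof -
  have "k \<le> n" using S card_mono[of "{1..n}" S] by simp
  \<comment> \<open>The values on \<open>S\<close> form an injection into a set of the same size,
    and the other \<open>n - k\<close> values are free. The proportion is thus the same for all
    \<open>S\<close>.\<close>
  have "card {f \<in> {1..n} \<rightarrow>\<^sub>E {1..k}. inj_on f S} = k ^ (n - k) * (\<Prod>i = 0..<k. k - i)"
    using card_inj_on_subset_funcset[of "{1..n}" "{1..k}" S] S by simp
  also have "(\<Prod>i = 0..<k. k - i) = fact k"
    by (simp add: fact_prod_rev)
  finally have "real (card {f \<in> {1..n} \<rightarrow>\<^sub>E {1..k}. inj_on f S}) = real k ^ (n - k) * fact k"
    by simp
  moreover have "real (card ({1..n} \<rightarrow>\<^sub>E {1..k})) = real k ^ (n - k) * real k ^ k"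
    using \<open>k \<le> n\<close> by (simp add: card_funcsetE flip: power_add)
  ultimately show ?thesis using k by simp
qed

text \<open>With \<open>m = max n 2\<close>, the factor 2 costs at most one more power of
  \<open>m\<close>, and \<open>1 + k\<close> is at most \<open>2 * k\<close>. The maximum also
  covers \<open>n = 1\<close>, where \<open>ln n\<close> would be 0.\<close>

lemma ln_double_binomial_le:
  assumes "1 \<le> k" "k \<le> n"
  shows "ln (2 * real (n choose k)) \<le> 2 * real k * ln (real (max n 2))"
proof -
  define m where "m = real (max n 2)"
  have m: "2 \<le> m" "real n \<le> m" by (auto simp: m_def)
  have "real (n choose k) \<le> real n ^ k"
    using binomial_le_pow[OF assms(2)] by (simp flip: of_nat_power)
  also have "\<dots> \<le> m ^ k" using m by (intro power_mono) auto
  finally have "2 * real (n choose k) \<le> m * m ^ k"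
    using m by (intro mult_mono) auto
  moreover have "0 < real (n choose k)" using assms by simp
  ultimately have "ln (2 * real (n choose k)) \<le> ln (m * m ^ k)"
    using m by (intro iffD2[OF ln_le_cancel_iff]) auto
  also have "\<dots> = (1 + real k) * ln m"
    using m by (simp add: ln_mult ln_realpow algebra_simps)
  also have "\<dots> \<le> 2 * real k * ln m"
    using m assms by (intro mult_right_mono) auto
  finally show ?thesis by (simp add: m_def)
qed

theorem theorem1:
  shows "\<exists>C::real. C > 0 \<and>
    (\<forall>(n::nat) (k::nat) (\<delta>::real). 1 \<le> k \<and> k \<le> n \<and> 1 < \<delta> \<and> \<delta> \<le> 2 \<longrightarrow>
      (\<exists>F. balanced_perfect_hash_family \<delta> n k F \<and>
        real (size F) \<le> C * (exp (real k) * sqrt (real k) * ln (real (max n 2)) / (\<delta> - 1)\<^sup>2)))"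
proof (intro exI[of _ "34 :: real"] conjI allI impI)
  fix n k :: nat and \<delta> :: real
  assume "1 \<le> k \<and> k \<le> n \<and> 1 < \<delta> \<and> \<delta> \<le> 2"
  then have k: "1 \<le> k" "k \<le> n" and \<delta>: "1 < \<delta>" "\<delta> \<le> 2" by auto
  define \<epsilon> where "\<epsilon> = \<delta> - 1"
  have \<epsilon>: "0 < \<epsilon>" "\<epsilon> \<le> 1" "\<delta> = 1 + \<epsilon>" using \<delta> by (auto simp: \<epsilon>_def)
  define p :: real where "p = fact k / real k ^ k"
  have p: "0 < p" "p \<le> 1"
    using k fact_le_power[of k, where 'a = real] by (simp_all add: p_def divide_le_eq)
  define L where "L = ln (real (max n 2))"
  have L: "1 / 2 \<le> L"
  proof -
    have "1 / 2 \<le> ln (2 :: real)" using ln_le_minus_one[of "1 / 2"] by (simp add: ln_div)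
    also have "\<dots> \<le> L" unfolding L_def by simp
    finally show ?thesis .
  qed
  \<comment> \<open>Up to a constant this is the required number of functions:
    \<open>32 * x * p * \<epsilon>^2 / 16\<close> is exactly the bound \<open>2 * k * L\<close> on
    the logarithm.\<close>
  define x where "x = real k * L / (p * \<epsilon>\<^sup>2)"
  have "1 / 2 \<le> x"
  proof -
    have "p * \<epsilon>\<^sup>2 \<le> 1" using p \<epsilon> by (intro mult_le_one power_le_one) auto
    moreover have "1 / 2 \<le> real k * L" using mult_mono[of 1 "real k" "1 / 2" L] k L by simp
    ultimately have "p * \<epsilon>\<^sup>2 * (1 / 2) \<le> real k * L" by simp
    then show ?thesis using p \<epsilon> by (simp add: x_def le_divide_eq mult.commute)
  qed
  \<comment> \<open>Rounding up adds at most 1, which is at most \<open>2 * x\<close>; hence the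
    constant 34.\<close>
  define M where "M = nat \<lceil>32 * x\<rceil>"
  have M: "32 * x \<le> real M" "real M \<le> 34 * x"
    using \<open>1 / 2 \<le> x\<close> unfolding M_def by linarith+
  define I where "I = {S. S \<subseteq> {1..n} \<and> card S = k}"
  have I: "finite I" "card I = n choose k"
    using n_subsets[of "{1..n}" k] by (auto simp: I_def)
  have "ln (2 * real (card I)) \<le> 2 * real k * L"
    using ln_double_binomial_le[OF k] by (simp add: I L_def)
  also have "\<dots> = 32 * x * (p * \<epsilon>\<^sup>2) / 16"
    using p \<epsilon> by (simp add: x_def)
  also have "\<dots> \<le> real M * (p * \<epsilon>\<^sup>2) / 16"
    using M p by (intro divide_right_mono mult_right_mono) auto
  finally have "ln (2 * real (card I)) \<le> real M * p * \<epsilon>\<^sup>2 / 16"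
    by (simp add: mult.assoc)
  moreover have "{1..n} \<rightarrow>\<^sub>E {1..k} \<noteq> {}" using k by (simp add: PiE_eq_empty_iff)
  ultimately obtain F where F: "set_mset F \<subseteq> {1..n} \<rightarrow>\<^sub>E {1..k}" "size F = M"
    and bal: "\<And>S. S \<in> I \<Longrightarrow> real M * p / \<delta> \<le> real (size {#f \<in># F. inj_on f S#}) \<and>
      real (size {#f \<in># F. inj_on f S#}) \<le> \<delta> * (real M * p)"
    using exists_balanced_multiset[of "{1..n} \<rightarrow>\<^sub>E {1..k}" I inj_on p \<epsilon> M] I p \<epsilon> k card_inj_on_PiE
    unfolding p_def I_def by (auto simp: finite_PiE)
  have "0 < real M * p" using M \<open>1 / 2 \<le> x\<close> p by simp
  then have "balanced_perfect_hash_family \<delta> n k F"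
    unfolding balanced_perfect_hash_family_def using F bal by (auto simp: I_def)
  moreover have "x \<le> exp (real k) * sqrt (real k) * L / \<epsilon>\<^sup>2"
  proof -
    \<comment> \<open>One of the two factors \<open>sqrt k\<close> of \<open>k\<close> is spent on
      Stirling's bound; the other is the one in the final size.\<close>
    have "real k * real k ^ k = real k ^ k * sqrt (real k) * sqrt (real k)"
      by (simp add: mult.assoc)
    also have "\<dots> \<le> exp (real k) * fact k * sqrt (real k)"
      using power_self_le_fact[OF k(1)] by (intro mult_right_mono) auto
    finally have "real k / p \<le> exp (real k) * sqrt (real k)"
      using p by (simp add: p_def divide_le_eq mult.commute mult.left_commute)
    then have "real k / p * (L / \<epsilon>\<^sup>2) \<le> exp (real k) * sqrt (real k) * (L / \<epsilon>\<^sup>2)"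
      using L by (intro mult_right_mono) auto
    then show ?thesis by (simp add: x_def)
  qed
  then have "real (size F) \<le> 34 * (exp (real k) * sqrt (real k) * L / \<epsilon>\<^sup>2)"
    using M F by simp
  ultimately show "\<exists>F. balanced_perfect_hash_family \<delta> n k F \<and>
      real (size F) \<le> 34 * (exp (real k) * sqrt (real k) * ln (real (max n 2)) / (\<delta> - 1)\<^sup>2)"
    unfolding L_def \<epsilon>_def by blast
qed simp

end
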